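(* Let $A\subseteq\mathbb{Z}$ be a finite set of integers of size $k=|A|\ge 1$. If $S=ba^A$ is a finite subset of the group $BS(1,2)$, then $|S|=k$ and $$|S^2|\ge 3k-2.$$ Moreover, if $k\ge 3$ and $$|S^2|=(3k-2)+h<4|S|-4,$$ then $h\ge 0$ and $S$ is a subset of a geometric progression $$S\subseteq\{ba^u,ba^{u+d},ba^{u+2d},\dots,ba^{u+(k+h-1)d}\}$$ of size $k+h\le 2k-3$, where $u=\min(A)$ and $d=d(A)$. Furthermore, if either $1\le k\le 2$, or $k\ge 3$ and $h=0$ (that is, $|S^2|=3k-2$), then $S$ is the geometric progression $$S=\{ba^u,ba^{u+d},ba^{u+2d},\dots,ba^{u+(k-1)d}\}.$$
   Context: $BS(1,2)=\langle a,b\mid ab=ba^2\rangle$ is the Baumslag-Solitar group. For finite $A\subseteq\mathbb{Z}$, $ba^A=\{ba^x: x\in A\}$. $S^2=\{s_1s_2: s_1,s_2\in S\}$. For $A=\{a_0<a_1<\dots<a_{k-1}\}$ with $k\ge 2$, $d(A)=\gcd(a_1-a_0,a_2-a_0,\dots,a_{k-1}-a_0)$; when $k=1$ the last displayed set is just $\{ba^u\}$ and $d$ plays no role. $|X|$ denotes the size of a finite set $X$. *)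

theory Defs
  imports "HOL-Algebra.Coset"
begin

datatype 'g letter = Gen 'g | Inv_Gen 'g

type_synonym 'g word = "'g letter list"

text \<open>
  The congruence on words over the generators and their formal inverses that is generated by free
  cancellation and by a set \<open>R\<close> of defining relations; a pair \<open>(u, v)\<close> in \<open>R\<close> stands for the
  relation \<open>u = v\<close>.
\<close>

inductive_set word_cong :: "('g word \<times> 'g word) set \<Rightarrow> ('g word \<times> 'g word) set"
  for R :: "('g word \<times> 'g word) set" where
  relation: "(u, v) \<in> R \<Longrightarrow> (u, v) \<in> word_cong R"
| cancel_right: "([Gen g, Inv_Gen g], []) \<in> word_cong R"
| cancel_left: "([Inv_Gen g, Gen g], []) \<in> word_cong R"
| refl: "(u, u) \<in> word_cong R"
| sym: "(u, v) \<in> word_cong R \<Longrightarrow> (v, u) \<in> word_cong R"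
| trans: "(u, v) \<in> word_cong R \<Longrightarrow> (v, w) \<in> word_cong R \<Longrightarrow> (u, w) \<in> word_cong R"
| append: "(u, u') \<in> word_cong R \<Longrightarrow> (v, v') \<in> word_cong R \<Longrightarrow> (u @ v, u' @ v') \<in> word_cong R"

definition word_class :: "('g word \<times> 'g word) set \<Rightarrow> 'g word \<Rightarrow> 'g word set" where
  "word_class R w = word_cong R `` {w}"

definition presented_group :: "('g word \<times> 'g word) set \<Rightarrow> 'g word set monoid" where
  "presented_group R =
     \<lparr>carrier = UNIV // word_cong R,
      mult = (\<lambda>X Y. \<Union>u\<in>X. \<Union>v\<in>Y. word_class R (u @ v)),
      one = word_class R []\<rparr>"

lemma equiv_word_cong: "equiv UNIV (word_cong R)"
  by (rule equivI)
    (auto simp: refl_on_def sym_def trans_def intro: word_cong.refl dest: word_cong.sym word_cong.trans)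

lemma word_class_eq_iff: "word_class R u = word_class R v \<longleftrightarrow> (u, v) \<in> word_cong R"
  unfolding word_class_def using eq_equiv_class_iff[OF equiv_word_cong] by blast

lemma carrier_presented_group: "carrier (presented_group R) = range (word_class R)"
  by (auto simp: presented_group_def quotient_def word_class_def)

lemma one_presented_group: "\<one>\<^bsub>presented_group R\<^esub> = word_class R []"
  by (simp add: presented_group_def)

lemma mult_presented_group:
  "word_class R u \<otimes>\<^bsub>presented_group R\<^esub> word_class R v = word_class R (u @ v)"
proof -
  have "word_class R (u' @ v') = word_class R (u @ v)"
    if "u' \<in> word_class R u" "v' \<in> word_class R v" for u' v'
  proof -
    have "(u, u') \<in> word_cong R" "(v, v') \<in> word_cong R"
      using that by (simp_all add: word_class_def)
    then have "(u @ v, u' @ v') \<in> word_cong R"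
      by (rule word_cong.append)
    then show ?thesis
      unfolding word_class_eq_iff by (rule word_cong.sym)
  qed
  moreover have "u \<in> word_class R u" "v \<in> word_class R v"
    by (simp_all add: word_class_def word_cong.refl)
  ultimately have "(\<Union>u'\<in>word_class R u. \<Union>v'\<in>word_class R v. word_class R (u' @ v')) = word_class R (u @ v)"
    by blast
  then show ?thesis
    by (simp add: presented_group_def)
qed

fun inv_letter :: "'g letter \<Rightarrow> 'g letter" where
  "inv_letter (Gen g) = Inv_Gen g"
| "inv_letter (Inv_Gen g) = Gen g"

lemma word_cong_inverse: "(rev (map inv_letter w) @ w, []) \<in> word_cong R"
proof (induction w)
  case Nil
  show ?case by (simp add: word_cong.refl)
next
  case (Cons x w)
  let ?v = "rev (map inv_letter w)"
  have "([inv_letter x, x], []) \<in> word_cong R"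
    by (cases x) (simp_all add: word_cong.cancel_left word_cong.cancel_right)
  then have "(?v @ [inv_letter x, x] @ w, ?v @ [] @ w) \<in> word_cong R"
    by (intro word_cong.append word_cong.refl)
  then have "(rev (map inv_letter (x # w)) @ x # w, ?v @ w) \<in> word_cong R"
    by simp
  then show ?case
    using Cons.IH by (rule word_cong.trans)
qed

lemma group_presented_group: "group (presented_group R)"
proof (rule groupI)
  fix x assume "x \<in> carrier (presented_group R)"
  then obtain w where x: "x = word_class R w"
    by (auto simp: carrier_presented_group)
  have "word_class R (rev (map inv_letter w)) \<otimes>\<^bsub>presented_group R\<^esub> x = \<one>\<^bsub>presented_group R\<^esub>"
    by (simp add: x mult_presented_group one_presented_group word_class_eq_iff word_cong_inverse)
  then show "\<exists>y\<in>carrier (presented_group R). y \<otimes>\<^bsub>presented_group R\<^esub> x = \<one>\<^bsub>presented_group R\<^esub>"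
    by (auto simp: carrier_presented_group)
qed (auto simp: carrier_presented_group mult_presented_group one_presented_group)

datatype bs_generator = Gen_a | Gen_b

definition bs12_relations :: "(bs_generator word \<times> bs_generator word) set" where
  "bs12_relations = {([Gen Gen_a, Gen Gen_b], [Gen Gen_b, Gen Gen_a, Gen Gen_a])}"

definition BS12 :: "bs_generator word set monoid" where
  "BS12 = presented_group bs12_relations"

definition bs_a :: "bs_generator word set" where
  "bs_a = word_class bs12_relations [Gen Gen_a]"

definition bs_b :: "bs_generator word set" where
  "bs_b = word_class bs12_relations [Gen Gen_b]"

lemma group_BS12: "group BS12"
  by (simp add: BS12_def group_presented_group)

lemma bs_generators_in_carrier: "bs_a \<in> carrier BS12" "bs_b \<in> carrier BS12"
  by (simp_all add: BS12_def bs_a_def bs_b_def carrier_presented_group)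

lemma bs12_relation: "bs_a \<otimes>\<^bsub>BS12\<^esub> bs_b = bs_b \<otimes>\<^bsub>BS12\<^esub> (bs_a [^]\<^bsub>BS12\<^esub> (2::nat))"
proof -
  interpret group BS12 by (rule group_BS12)
  have "bs_a [^]\<^bsub>BS12\<^esub> (2::nat) = bs_a \<otimes>\<^bsub>BS12\<^esub> bs_a"
    using bs_generators_in_carrier by (simp add: numeral_2_eq_2)
  moreover have "([Gen Gen_a, Gen Gen_b], [Gen Gen_b, Gen Gen_a, Gen Gen_a]) \<in> word_cong bs12_relations"
    by (rule word_cong.relation) (simp add: bs12_relations_def)
  ultimately show ?thesis
    by (simp add: BS12_def bs_a_def bs_b_def mult_presented_group word_class_eq_iff)
qed

definition ba_pow :: "int \<Rightarrow> bs_generator word set" where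
  "ba_pow x = bs_b \<otimes>\<^bsub>BS12\<^esub> (bs_a [^]\<^bsub>BS12\<^esub> x)"

definition ba_set :: "int set \<Rightarrow> bs_generator word set set" where
  "ba_set A = ba_pow ` A"

text \<open>If \<open>A\<close> is a singleton, the set of differences is empty and the value is \<open>0\<close>.\<close>

definition diff_gcd :: "int set \<Rightarrow> int" where
  "diff_gcd A = Gcd ((\<lambda>x. x - Min A) ` (A - {Min A}))"

end

theory Submission
  imports Defs Complex_Main "HOL-Library.Set_Algebras"
begin

text \<open>
  Since \<open>a\<^sup>x b = b a\<^bsup>2x\<^esup>\<close>, the square of \<open>S\<close> has as many elements as \<open>A + 2 \<cdot> A\<close>. After an affine
  normalisation \<open>A\<close> has minimum \<open>0\<close>, maximum \<open>l\<close> and gcd \<open>1\<close>. Writing \<open>A = 2 \<cdot> E \<union> (2 \<cdot> D + 1)\<close>, the even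
  and odd elements of \<open>A + 2 \<cdot> A\<close> are counted by \<open>A + E\<close> and \<open>A + D\<close>, and \<open>E\<close>, \<open>D\<close> are shorter than \<open>A\<close>.
  The Lev-Smeliansky inequality \<open>|A + B| \<ge> min (l + |B|) (|A| + 2|B| - 2)\<close> for both of them gives
  \<open>|A + 2 \<cdot> A| \<ge> min (l + 2k - 1) (4k - 4)\<close>. It is deduced from Kneser's theorem in \<open>\<int>/l\<close>, where
  subsets and subgroups of \<open>\<int>/l\<close> are represented by \<open>l\<close>-periodic sets of integers and by the
  divisors \<open>d\<close> of \<open>l\<close> (the subgroup \<open>d\<int>/l\<int>\<close> has \<open>l div d\<close> elements).
\<close>

subsection \<open>Periodic sets of integers\<close>

definition periodic :: "int \<Rightarrow> int set \<Rightarrow> bool" where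
  "periodic d X \<longleftrightarrow> (\<forall>x. x + d \<in> X \<longleftrightarrow> x \<in> X)"

text \<open>The size of the image of \<open>X\<close> in \<int>/l, which is meaningful for infinite
  periodic sets too.\<close>

definition rcount :: "int \<Rightarrow> int set \<Rightarrow> nat" where
  "rcount l X = card ((\<lambda>x. x mod l) ` X)"

lemma periodicI: "(\<And>x. x + d \<in> X \<longleftrightarrow> x \<in> X) \<Longrightarrow> periodic d X"
  by (simp add: periodic_def)

lemma periodicD: "periodic d X \<Longrightarrow> x + d \<in> X \<longleftrightarrow> x \<in> X"
  by (simp add: periodic_def)

lemma periodic_uminus: "periodic d X \<Longrightarrow> periodic (- d) X"
  unfolding periodic_def by (metis add.right_neutral add.assoc left_minus)

lemma periodic_times:
  assumes "periodic d X" shows "periodic (n * d) X"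
proof -
  have *: "periodic (int m * c) X" if "periodic c X" for m c
  proof (induction m)
    case (Suc m)
    have "x + int (Suc m) * c = (x + int m * c) + c" for x by (simp add: algebra_simps)
    then show ?case using Suc that unfolding periodic_def by (metis add.assoc)
  qed (simp add: periodic_def)
  show ?thesis
  proof (cases "n \<ge> 0")
    case True then show ?thesis using *[OF assms, of "nat n"] by simp
  next
    case False then show ?thesis using *[OF periodic_uminus[OF assms], of "nat (- n)"] by simp
  qed
qed

lemma periodic_dvd: "periodic d X \<Longrightarrow> d dvd e \<Longrightarrow> periodic e X"
  by (metis dvdE mult.commute periodic_times)

lemma periodic_cong:
  assumes "periodic d X" "x mod d = y mod d" shows "x \<in> X \<longleftrightarrow> y \<in> X"
proof -
  obtain n where "x = y + n * d"
    by (metis assms(2) mod_eqE mult.commute)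
  then show ?thesis using periodicD[OF periodic_times[OF assms(1), of n], of y] by simp
qed

lemma periodic_Un: "periodic d X \<Longrightarrow> periodic d Y \<Longrightarrow> periodic d (X \<union> Y)"
  and periodic_Diff: "periodic d X \<Longrightarrow> periodic d Y \<Longrightarrow> periodic d (X - Y)"
  by (simp_all add: periodic_def)

lemma mem_translate: "x \<in> (+) e ` X \<longleftrightarrow> x - e \<in> (X :: int set)"
  by force

lemma periodic_translate: "periodic d X \<Longrightarrow> periodic d ((+) e ` X)"
  unfolding periodic_def mem_translate by (metis add_diff_eq diff_add_eq)

lemma finite_residues:
  assumes "0 < (l::int)" shows "finite ((\<lambda>x. x mod l) ` X)"
proof (rule finite_subset)
  show "(\<lambda>x. x mod l) ` X \<subseteq> {0..<l}" using assms by auto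
qed simp

lemma rcount_le_card: "finite X \<Longrightarrow> rcount l X \<le> card X"
  unfolding rcount_def by (rule card_image_le)

lemma rcount_mono: "0 < l \<Longrightarrow> X \<subseteq> Y \<Longrightarrow> rcount l X \<le> rcount l Y"
  unfolding rcount_def by (intro card_mono finite_residues image_mono)

lemma rcount_Un_le: "rcount l (X \<union> Y) \<le> rcount l X + rcount l Y"
  unfolding rcount_def image_Un by (rule card_Un_le)

text \<open>Periodicity of one set is enough: a residue shared with \<open>Y\<close> would put an
  element of \<open>Y\<close> into \<open>X\<close>.\<close>

lemma rcount_Un_disjoint:
  assumes "0 < l" "periodic l X" "X \<inter> Y = {}"
  shows "rcount l (X \<union> Y) = rcount l X + rcount l Y"
  unfolding rcount_def image_Un
proof (rule card_Un_disjoint)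
  show "(\<lambda>x. x mod l) ` X \<inter> (\<lambda>x. x mod l) ` Y = {}"
  proof (rule ccontr)
    assume "\<not> ?thesis"
    then obtain x y where "x \<in> X" "y \<in> Y" "x mod l = y mod l" by blast
    then show False using assms(3) periodic_cong[OF assms(2)] by blast
  qed
qed (simp_all add: assms finite_residues)

lemma rcount_pos: "0 < l \<Longrightarrow> X \<noteq> {} \<Longrightarrow> 0 < rcount l X"
  by (simp add: rcount_def card_gt_0_iff finite_residues)

lemma rcount_translate: "rcount l ((+) e ` X) = rcount l X"
proof -
  have "(\<lambda>x. x mod l) ` (+) e ` X = (\<lambda>r. (e + r) mod l) ` (\<lambda>x. x mod l) ` X"
    by (simp add: image_image mod_add_right_eq)
  moreover have "inj_on (\<lambda>r. (e + r) mod l) ((\<lambda>x. x mod l) ` X)"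
  proof (rule inj_onI, clarsimp)
    fix x y assume "(e + x mod l) mod l = (e + y mod l) mod l"
    then have "(e + x) mod l = (e + y) mod l" by (simp add: mod_add_right_eq)
    then have "(e + x - e) mod l = (e + y - e) mod l" by (rule mod_diff_cong) simp
    then show "x mod l = y mod l" by simp
  qed
  ultimately show ?thesis by (simp add: rcount_def card_image)
qed

text \<open>A residue modulo \<open>l\<close> consists of its residue modulo \<open>d\<close> and a
  digit \<open>i\<close> below \<open>l div d\<close>.\<close>

lemma residues_subset_digits:
  fixes d :: int
  assumes "0 < d" "d dvd l" "0 < l"
  shows "(\<lambda>x. x mod l) ` X \<subseteq> (\<lambda>(r, i). r + d * i) ` (((\<lambda>x. x mod d) ` X) \<times> {0..<l div d})"
proof
  fix z assume "z \<in> (\<lambda>x. x mod l) ` X"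
  then obtain x where x: "x \<in> X" "z = x mod l" by auto
  have "z mod d = x mod d" using assms(2) x by (simp add: mod_mod_cancel)
  then have "z = x mod d + d * (z div d)" by (metis mod_mult_div_eq)
  moreover have "0 \<le> z div d"
    using assms x by (simp add: pos_imp_zdiv_nonneg_iff)
  moreover have "z div d < l div d"
  proof (rule ccontr)
    assume "\<not> z div d < l div d"
    then have "l div d * d \<le> z div d * d" using assms(1) by simp
    also have "\<dots> \<le> z" using assms(1) by (metis le_add_same_cancel1 mod_div_mult_eq pos_mod_sign add.commute)
    finally show False using assms x pos_mod_bound[OF assms(3), of x] by simp
  qed
  ultimately show "z \<in> (\<lambda>(r, i). r + d * i) ` (((\<lambda>x. x mod d) ` X) \<times> {0..<l div d})"
    using x(1) by force
qed

lemma rcount_le: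
  fixes d :: int
  assumes "0 < d" "d dvd l" "0 < l"
  shows "rcount l X \<le> nat (l div d) * rcount d X"
proof -
  have "rcount l X \<le> card (((\<lambda>x. x mod d) ` X) \<times> {0..<l div d})"
    unfolding rcount_def using assms
    by (intro surj_card_le[OF _ residues_subset_digits]) (simp_all add: finite_residues)
  then show ?thesis by (simp add: rcount_def card_cartesian_product mult.commute)
qed

text \<open>A \<open>d\<close>-periodic set contains every lift of its residues modulo
  \<open>d\<close>, so all digits occur.\<close>

lemma rcount_periodic:
  fixes d :: int
  assumes "0 < d" "d dvd l" "0 < l" "periodic d X"
  shows "rcount l X = nat (l div d) * rcount d X"
proof -
  let ?f = "\<lambda>(r, i). r + d * i" and ?P = "((\<lambda>x. x mod d) ` X) \<times> {0..<l div d}"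
  have mod: "(x mod d + d * i) mod d = x mod d" for x i by simp
  have inj: "inj_on ?f ?P"
  proof (rule inj_onI, clarsimp)
    fix x y i j assume eq: "x mod d + d * i = y mod d + d * j"
    then have "x mod d = y mod d" using mod by metis
    then show "x mod d = y mod d \<and> i = j" using eq assms(1) by simp
  qed
  have "?f ` ?P \<subseteq> (\<lambda>x. x mod l) ` X"
  proof clarsimp
    fix x i assume x: "x \<in> X" and i: "0 \<le> i" "i < l div d"
    let ?z = "x mod d + d * i"
    have "?z \<in> X" using periodic_cong[OF assms(4) mod] x by blast
    moreover have "?z mod l = ?z"
    proof (rule mod_pos_pos_trivial)
      have "x mod d < d" using assms(1) by simp
      moreover have "d * (i + 1) \<le> d * (l div d)" using i assms(1) by simp
      ultimately show "?z < l" using assms(2) by (simp add: algebra_simps)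
    qed (use assms(1) i in simp)
    ultimately show "?z \<in> (\<lambda>x. x mod l) ` X" by (metis image_eqI)
  qed
  then have "?f ` ?P = (\<lambda>x. x mod l) ` X"
    using residues_subset_digits[OF assms(1-3), of X] by blast
  then have "rcount l X = card ?P"
    unfolding rcount_def using card_image[OF inj] by simp
  then show ?thesis by (simp add: rcount_def card_cartesian_product mult.commute)
qed

text \<open>The Chinese remainder theorem for moduli that need not be coprime.\<close>

lemma crt_exists:
  fixes d1 d2 r s :: int
  assumes "r mod gcd d1 d2 = s mod gcd d1 d2"
  obtains y where "y mod d1 = r mod d1" "y mod d2 = s mod d2"
proof -
  obtain u v where uv: "u * d1 + v * d2 = gcd d1 d2" by (metis bezout_int)
  obtain m where m: "s - r = gcd d1 d2 * m"
    by (metis assms dvdE mod_eq_dvd_iff)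
  \<comment> \<open>The Bezout identity splits \<open>s - r\<close> into multiples of
    \<open>d1\<close> and of \<open>d2\<close>; adding only the first to \<open>r\<close> leaves
    \<open>y\<close> congruent to \<open>s\<close> modulo \<open>d2\<close>.\<close>
  define y where "y = r + d1 * (u * m)"
  have "s = r + (u * d1 + v * d2) * m" using m uv by simp
  then have "y = s + d2 * (- v * m)" by (simp add: y_def algebra_simps)
  then have "y mod d2 = s mod d2" by (metis mod_mult_self2)
  moreover have "y mod d1 = r mod d1" by (simp add: y_def)
  ultimately show thesis using that by blast
qed

lemma card_residue_class:
  fixes d g x :: int
  assumes "0 < d" "g dvd d" "0 < g"
  shows "card {r \<in> {0..<d}. r mod g = x mod g} = nat (d div g)"
proof -
  let ?X = "{r. r mod g = x mod g}"
  have "(\<lambda>r. r mod d) ` ?X = {r \<in> {0..<d}. r mod g = x mod g}"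
  proof (intro equalityI subsetI)
    fix z assume "z \<in> {r \<in> {0..<d}. r mod g = x mod g}"
    then have "z = z mod d" "z \<in> ?X" by auto
    then show "z \<in> (\<lambda>r. r mod d) ` ?X" by blast
  qed (use assms in \<open>auto simp: mod_mod_cancel\<close>)
  moreover have "periodic g ?X" by (rule periodicI) simp
  moreover have "(\<lambda>r. r mod g) ` ?X = {x mod g}" by auto
  ultimately show ?thesis
    using rcount_periodic[OF assms(3,2,1), of ?X] by (simp add: rcount_def)
qed

subsection \<open>Kneser's theorem in cyclic groups\<close>

text \<open>The map to the pair of residues modulo \<open>d1\<close> and \<open>d2\<close> factors
  through the residues modulo \<open>e\<close>, and by the Chinese remainder theorem every pair in
  the product comes from an element of \<open>X \<inter> Y\<close>.\<close>

lemma rcount_grid: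
  fixes d1 d2 x :: int
  defines "g \<equiv> gcd d1 d2" and "e \<equiv> lcm d1 d2"
  assumes pos: "0 < d1" "0 < d2" and per: "periodic d1 X" "periodic d2 Y"
  shows "card ({r \<in> {0..<d1}. r mod g = x mod g} \<inter> X) * card ({r \<in> {0..<d2}. r mod g = x mod g} \<inter> Y)
    \<le> rcount e (X \<inter> Y)"
proof -
  let ?U = "{r \<in> {0..<d1}. r mod g = x mod g} \<inter> X" and ?V = "{r \<in> {0..<d2}. r mod g = x mod g} \<inter> Y"
  let ?f = "\<lambda>y. (y mod d1, y mod d2)"
  have e: "0 < e" "d1 dvd e" "d2 dvd e" using pos by (simp_all add: e_def lcm_pos_int)
  have "?U \<times> ?V \<subseteq> ?f ` (\<lambda>y. y mod e) ` (X \<inter> Y)"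
  proof clarify
    fix r s assume r: "r \<in> {0..<d1}" "r mod g = x mod g" "r \<in> X"
      and s: "s \<in> {0..<d2}" "s mod g = x mod g" "s \<in> Y"
    obtain y where y: "y mod d1 = r mod d1" "y mod d2 = s mod d2"
      using crt_exists[of r d1 d2 s] r s by (auto simp: g_def)
    have "y \<in> X \<inter> Y" using periodic_cong[OF per(1) y(1)] periodic_cong[OF per(2) y(2)] r s by simp
    moreover have "?f (y mod e) = (r, s)"
      using r s y e by (simp add: mod_mod_cancel)
    ultimately show "(r, s) \<in> ?f ` (\<lambda>y. y mod e) ` (X \<inter> Y)"
      by (intro image_eqI[of _ ?f "y mod e"] imageI) simp_all
  qed
  then have "card (?U \<times> ?V) \<le> rcount e (X \<inter> Y)"
    unfolding rcount_def by (intro surj_card_le finite_residues e)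
  then show ?thesis by (simp add: card_cartesian_product)
qed

lemma card_Int_Compl:
  assumes "finite R" shows "card R = card (R \<inter> X) + card (R \<inter> - X)"
proof -
  have "R = (R \<inter> X) \<union> (R \<inter> - X)" by blast
  moreover have "card ((R \<inter> X) \<union> (R \<inter> - X)) = card (R \<inter> X) + card (R \<inter> - X)"
    using assms by (intro card_Un_disjoint) auto
  ultimately show ?thesis by simp
qed

text \<open>
  Inside the class of \<open>x\<close> modulo \<open>gcd d1 d2\<close>, the residues modulo \<open>lcm d1 d2\<close> form a grid whose rows and
  columns are the classes modulo \<open>d1\<close> and \<open>d2\<close>. There \<open>X\<close> is a union of rows and \<open>Y\<close> one of columns;
  \<open>u\<close> counts the rows outside \<open>X\<close> and \<open>v\<close> the columns inside \<open>Y\<close>.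
\<close>

lemma grid_corners:
  fixes d1 d2 :: int
  defines "e \<equiv> lcm d1 d2"
  assumes pos: "0 < d1" "0 < d2" and per: "periodic d1 X" "periodic d2 Y" and x: "x \<in> Y - X"
  obtains u v where "1 \<le> u" "u \<le> nat (e div d2)" "1 \<le> v" "v \<le> nat (e div d1)"
    "u * v \<le> rcount e (Y - X)" "(nat (e div d2) - u) * (nat (e div d1) - v) \<le> rcount e (X - Y)"
proof -
  define g where "g = gcd d1 d2"
  have g: "0 < g" "g dvd d1" "g dvd d2" using pos by (simp_all add: g_def)
  have ge: "d1 * d2 = g * e" using pos by (simp add: g_def e_def)
  \<comment> \<open>These are the numbers of rows and of columns of the grid.\<close>
  have n: "e div d2 = d1 div g" "e div d1 = d2 div g"
  proof -
    obtain a b where ab: "d1 = g * a" "d2 = g * b" using g by (elim dvdE)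
    then have "e = g * a * b" using ge g by (simp add: algebra_simps)
    then show "e div d2 = d1 div g" "e div d1 = d2 div g" using ab g pos by auto
  qed
  let ?R = "{r \<in> {0..<d1}. r mod g = x mod g}" and ?S = "{r \<in> {0..<d2}. r mod g = x mod g}"
  have fin: "finite ?R" "finite ?S"
    by (rule finite_subset[of _ "{0..<d1}"]; force) (rule finite_subset[of _ "{0..<d2}"]; force)
  have card: "card ?R = nat (e div d2)" "card ?S = nat (e div d1)"
    using card_residue_class[of d1 g x] card_residue_class[of d2 g x] pos g n by simp_all
  define u where "u = card (?R \<inter> - X)"
  define v where "v = card (?S \<inter> Y)"
  have u': "card (?R \<inter> X) = nat (e div d2) - u"
  proof -
    have "card ?R = card (?R \<inter> X) + card (?R \<inter> - X)"
      by (rule card_Int_Compl) (rule fin)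
    then show ?thesis using card by (simp add: u_def)
  qed
  have v': "card (?S \<inter> - Y) = nat (e div d1) - v"
  proof -
    have "card ?S = card (?S \<inter> Y) + card (?S \<inter> - Y)"
      by (rule card_Int_Compl) (rule fin)
    then show ?thesis using card by (simp add: v_def)
  qed
  have per': "periodic d1 (- X)" "periodic d2 (- Y)" using per by (simp_all add: periodic_def)
  \<comment> \<open>The row of \<open>x\<close> itself is outside \<open>X\<close> and its column is
    inside \<open>Y\<close>.\<close>
  have "x mod d1 \<in> ?R \<inter> - X" "x mod d2 \<in> ?S \<inter> Y"
    using x pos g periodic_cong[OF per(1), of "x mod d1" x] periodic_cong[OF per(2), of "x mod d2" x]
    by (auto simp: mod_mod_cancel)
  moreover have "finite (?R \<inter> - X)" "finite (?S \<inter> Y)" using fin by blast+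
  ultimately have "0 < u" "0 < v" unfolding u_def v_def card_gt_0_iff by blast+
  then have "1 \<le> u" "1 \<le> v" by simp_all
  moreover have "u \<le> nat (e div d2)" "v \<le> nat (e div d1)"
    unfolding u_def v_def card[symmetric] by (intro card_mono fin Int_lower1)+
  moreover have "u * v \<le> rcount e (Y - X)"
    using rcount_grid[OF pos per'(1) per(2), of x] by (simp add: u_def v_def g_def e_def Diff_eq Int_commute[of Y])
  moreover have "(nat (e div d2) - u) * (nat (e div d1) - v) \<le> rcount e (X - Y)"
    using rcount_grid[OF pos per(1) per'(2), of x] u' v' by (simp add: g_def e_def Diff_eq)
  ultimately show thesis using that by blast
qed

lemma mult_complement_ge:
  fixes u n :: nat
  assumes "1 \<le> u" "u < n" shows "n - 1 \<le> u * (n - u)"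
proof -
  obtain p q where "u = Suc p" "n = Suc (Suc (p + q))"
    using assms by (metis Suc_le_D One_nat_def less_iff_Suc_add add_Suc)
  then show ?thesis by simp
qed

text \<open>Comparing \<open>u\<close> with \<open>n1 - v\<close> bounds one of the products from
  below by a product of two complementary numbers.\<close>

lemma grid_interior:
  fixes n1 n2 :: nat
  assumes "1 \<le> u" "u < n2" "1 \<le> v" "v < n1"
  shows "n1 - 1 \<le> u * v \<or> n2 - 1 \<le> (n2 - u) * (n1 - v)"
proof (cases "n1 - v \<le> u")
  case True
  have "n1 - 1 \<le> v * (n1 - v)" using assms by (intro mult_complement_ge) simp_all
  also have "\<dots> \<le> v * u" using True by simp
  finally show ?thesis by (simp add: mult.commute)
next
  case False
  have "n2 - 1 \<le> u * (n2 - u)" using assms by (intro mult_complement_ge) simp_all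
  also have "\<dots> \<le> (n1 - v) * (n2 - u)" using False by simp
  finally show ?thesis by (simp add: mult.commute)
qed

text \<open>The grid through a point of \<open>Y - X\<close> settles the claim unless all its rows
  lie outside \<open>X\<close>; then it supplies at least \<open>?n2\<close> residues of
  \<open>Y - X\<close>. The grid through a point of \<open>X - Y\<close> behaves likewise with the
  roles exchanged.\<close>

lemma periodic_difference_bound:
  fixes d1 d2 :: int
  defines "e \<equiv> lcm d1 d2"
  assumes pos: "0 < d1" "0 < d2" and per: "periodic d1 X" "periodic d2 Y"
    and ne: "Y - X \<noteq> {}" "X - Y \<noteq> {}"
  shows "nat (e div d1) \<le> rcount e (Y - X) + 1 \<or> nat (e div d2) \<le> rcount e (X - Y) + 1"
proof -
  let ?n1 = "nat (e div d1)" and ?n2 = "nat (e div d2)"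
  let ?M1 = "rcount e (Y - X)" and ?M2 = "rcount e (X - Y)"
  obtain x y where "x \<in> Y - X" "y \<in> X - Y" using ne by blast
  obtain u v where uv: "1 \<le> u" "u \<le> ?n2" "1 \<le> v" "v \<le> ?n1" "u * v \<le> ?M1" "(?n2 - u) * (?n1 - v) \<le> ?M2"
    using grid_corners[OF pos per \<open>x \<in> Y - X\<close>] unfolding e_def by metis
  obtain a b where ab: "1 \<le> a" "a \<le> ?n1" "1 \<le> b" "b \<le> ?n2" "a * b \<le> ?M2" "(?n1 - a) * (?n2 - b) \<le> ?M1"
    using grid_corners[OF pos(2,1) per(2,1) \<open>y \<in> X - Y\<close>] unfolding e_def lcm.commute[of d2] by metis
  have *: "?thesis \<or> (u = ?n2 \<and> ?n2 \<le> ?M1)"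
  proof -
    consider "v = ?n1" | "u = ?n2" | "u < ?n2" "v < ?n1" using uv by linarith
    then show ?thesis
    proof cases
      case 1
      then have "?n1 \<le> u * v" using uv by simp
      then show ?thesis using uv by linarith
    next
      case 2
      then have "?n2 \<le> u * v" using uv by simp
      then show ?thesis using 2 uv by linarith
    next
      case 3
      then show ?thesis using grid_interior[of u ?n2 v ?n1] uv by linarith
    qed
  qed
  have "?thesis \<or> (a = ?n1 \<and> ?n1 \<le> ?M2)"
  proof -
    consider "b = ?n2" | "a = ?n1" | "a < ?n1" "b < ?n2" using ab by linarith
    then show ?thesis
    proof cases
      case 1
      then have "?n2 \<le> a * b" using ab by simp
      then show ?thesis using ab by linarith
    next
      case 2
      then have "?n1 \<le> a * b" using ab by simp
      then show ?thesis using 2 ab by linarith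
    next
      case 3
      then show ?thesis using grid_interior[of a ?n1 b ?n2] ab by linarith
    qed
  qed
  \<comment> \<open>Were the claim false, the two exceptional cases would give
    \<open>?n2 \<le> ?M1 < ?n1 \<le> ?M2 < ?n2\<close>.\<close>
  then show ?thesis using * by linarith
qed

text \<open>This allows Kneser's bound to be assembled from local pieces. If neither set contains
  the other, the union has period \<open>lcm d1 d2\<close>, and for one of the two sets the residues
  gained make up for the smaller subgroup.\<close>

lemma periodic_union:
  fixes d1 d2 l :: int
  assumes l: "0 < l" and d1: "0 < d1" "d1 dvd l" "periodic d1 X" and d2: "0 < d2" "d2 dvd l" "periodic d2 Y"
    and n: "n \<le> rcount l X + nat (l div d1)" "n \<le> rcount l Y + nat (l div d2)"
  obtains d where "0 < d" "d dvd l" "periodic d (X \<union> Y)" "n \<le> rcount l (X \<union> Y) + nat (l div d)"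
proof -
  consider "Y \<subseteq> X" | "X \<subseteq> Y" | "Y - X \<noteq> {}" "X - Y \<noteq> {}" by blast
  then show thesis
  proof cases
    case 1
    then show thesis using that[OF d1(1,2)] d1(3) n(1) by (simp add: Un_absorb2)
  next
    case 2
    then show thesis using that[OF d2(1,2)] d2(3) n(2) by (simp add: Un_absorb1)
  next
    case 3
    define e where "e = lcm d1 d2"
    have e: "0 < e" "e dvd l" "d1 dvd e" "d2 dvd e" using d1 d2 by (simp_all add: e_def lcm_pos_int)
    have per: "periodic e X" "periodic e Y" using d1 d2 e periodic_dvd by blast+
    let ?m = "nat (l div e)"
    have div: "nat (l div d) = ?m * nat (e div d)" if "d dvd e" "0 < d" for d
    proof -
      have "l div d = l div e * (e div d)"
        using that e by (metis div_mult_swap dvd_div_mult_self)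
      then show ?thesis using that e l
        by (simp add: nat_mult_distrib pos_imp_zdiv_nonneg_iff)
    qed
    have X: "rcount l (X \<union> Y) = rcount l X + ?m * rcount e (Y - X)"
      using rcount_Un_disjoint[of l X "Y - X"] rcount_periodic[OF e(1,2) l, of "Y - X"]
        periodic_Diff[OF per(2,1)] periodic_dvd[OF d1(3,2)] l by simp
    have Y: "rcount l (X \<union> Y) = rcount l Y + ?m * rcount e (X - Y)"
      using rcount_Un_disjoint[of l Y "X - Y"] rcount_periodic[OF e(1,2) l, of "X - Y"]
        periodic_Diff[OF per] periodic_dvd[OF d2(3,2)] l by (simp add: Un_commute)
    have "n \<le> rcount l (X \<union> Y) + ?m"
      using periodic_difference_bound[OF d1(1) d2(1) d1(3) d2(3) 3, folded e_def]
    proof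
      assume "nat (e div d1) \<le> rcount e (Y - X) + 1"
      then have "?m * nat (e div d1) \<le> ?m * (rcount e (Y - X) + 1)" by (rule mult_le_mono2)
      then show ?thesis using n(1) X div[OF e(3) d1(1)] by simp
    next
      assume "nat (e div d2) \<le> rcount e (X - Y) + 1"
      then have "?m * nat (e div d2) \<le> ?m * (rcount e (X - Y) + 1)" by (rule mult_le_mono2)
      then show ?thesis using n(2) Y div[OF e(4) d2(1)] by simp
    qed
    then show thesis using that[OF e(1,2)] periodic_Un[OF per] by blast
  qed
qed

section \<open>Stabilisers and the Dyson transform\<close>

text \<open>After \<open>l\<close> steps of length \<open>p\<close> a point is back in its class
  modulo \<open>l\<close>, so \<open>l - 1\<close> further steps lead from \<open>x + p\<close> to
  the class of \<open>x\<close>.\<close>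

lemma one_sided_periodic:
  assumes l: "0 < l" "periodic l A" and p: "\<And>x. x \<in> A \<Longrightarrow> x + p \<in> A"
  shows "periodic p A"
proof (rule periodicI)
  fix x
  have iter: "y + int n * p \<in> A" if "y \<in> A" for y n
  proof (induction n)
    case (Suc n)
    then show ?case using p[of "y + int n * p"] by (simp add: algebra_simps)
  qed (simp add: that)
  have "x \<in> A" if "x + p \<in> A"
  proof -
    have "x + p + int (nat (l - 1)) * p \<in> A" using that by (rule iter)
    moreover have "x + p + int (nat (l - 1)) * p = x + p * l"
    proof -
      have *: "int (nat (l - 1)) = l - 1" using l(1) by simp
      show ?thesis unfolding * by (simp add: algebra_simps)
    qed
    ultimately show ?thesis using periodicD[OF periodic_times[OF l(2), of p], of x] by metis
  qed
  then show "x + p \<in> A \<longleftrightarrow> x \<in> A" using p by blast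
qed

text \<open>The periods form a subgroup of \<int>, and division with remainder shows that the least
  positive one generates it.\<close>

lemma minimal_period:
  assumes l: "0 < l" "periodic l A"
  obtains d where "0 < d" "periodic d A" "\<And>p. periodic p A \<Longrightarrow> d dvd p"
proof -
  define d where "d = int (LEAST n. 0 < n \<and> periodic (int n) A)"
  have "0 < nat l \<and> periodic (int (nat l)) A" using l by simp
  from LeastI[of "\<lambda>n. 0 < n \<and> periodic (int n) A", OF this] have d: "0 < d" "periodic d A"
    by (simp_all add: d_def)
  have "d dvd p" if "periodic p A" for p
  proof (rule ccontr)
    assume "\<not> d dvd p"
    then have pos: "0 < p mod d" using d(1) by (metis dvd_eq_mod_eq_0 order_le_less pos_mod_sign)
    have "periodic (p mod d) A"
    proof (rule periodicI)
      fix x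
      have "x + p mod d = x + p + (- (p div d)) * d" by (simp add: minus_div_mult_eq_mod[symmetric])
      then show "x + p mod d \<in> A \<longleftrightarrow> x \<in> A"
        using periodicD[OF periodic_times[OF d(2)]] periodicD[OF that] by metis
    qed
    then have "0 < nat (p mod d) \<and> periodic (int (nat (p mod d))) A" using pos by simp
    then have "nat d \<le> nat (p mod d)" unfolding d_def nat_int by (rule Least_le)
    then show False using pos pos_mod_bound[OF d(1), of p] by simp
  qed
  then show thesis using that d by blast
qed

text \<open>
  The Dyson transform replaces \<open>(A, B)\<close> by \<open>(A \<union> (B + e), B \<inter> (A - e))\<close>. It preserves \<open>|A| + |B|\<close>, does not
  enlarge \<open>A + B\<close>, and for \<open>e = a - b0\<close> keeps \<open>a0\<close> and \<open>b0\<close>. If no transform shrinks \<open>B\<close>, then \<open>B - b0\<close>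
  lies in the stabiliser of \<open>A\<close>.
\<close>

lemma kneser_piece:
  assumes l: "0 < l" and "periodic l A" "periodic l B" "a0 \<in> A" "b0 \<in> B"
  shows "\<exists>C d. 0 < d \<and> d dvd l \<and> periodic d C \<and> a0 + b0 \<in> C \<and> C \<subseteq> A + B
    \<and> rcount l A + rcount l B \<le> rcount l C + nat (l div d)"
  using assms(2-)
proof (induction "rcount l B" arbitrary: A B rule: less_induct)
  case (less B A)
  note A = \<open>periodic l A\<close> and B = \<open>periodic l B\<close> and a0 = \<open>a0 \<in> A\<close> and b0 = \<open>b0 \<in> B\<close>
  show ?case
  proof (cases "\<exists>a\<in>A. \<exists>b\<in>B. a + (b - b0) \<notin> A")
    case True
    then obtain a b where ab: "a \<in> A" "b \<in> B" "a + (b - b0) \<notin> A" by blast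
    define e where "e = a - b0"
    define A' where "A' = A \<union> (+) e ` B"
    define B' where "B' = {x \<in> B. x + e \<in> A}"
    have perB': "periodic l B'"
    proof (rule periodicI)
      fix x
      have "x + l + e = (x + e) + l" by simp
      then show "x + l \<in> B' \<longleftrightarrow> x \<in> B'"
        unfolding B'_def mem_Collect_eq using periodicD[OF A, of "x + e"] periodicD[OF B, of x] by metis
    qed
    have perA': "periodic l A'"
      unfolding A'_def by (intro periodic_Un A periodic_translate B)
    \<comment> \<open>\<open>b0 + e\<close> equals \<open>a\<close>, so \<open>b0\<close> survives
      the transform.\<close>
    have b0': "b0 \<in> B'" using ab b0 by (simp add: B'_def e_def)
    \<comment> \<open>The elements that leave \<open>B\<close>, shifted by \<open>e\<close>, are
      exactly those that are new in \<open>A'\<close>.\<close>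
    have split: "B = B' \<union> (B - B')" "A' = A \<union> (+) e ` (B - B')"
      by (auto simp: B'_def A'_def add.commute)
    have b: "rcount l B = rcount l B' + rcount l (B - B')"
      using rcount_Un_disjoint[OF l perB', of "B - B'"] split(1) by simp
    have a: "rcount l A' = rcount l A + rcount l (B - B')"
      unfolding split(2)
      using rcount_Un_disjoint[OF l A, of "(+) e ` (B - B')"] rcount_translate[of l e "B - B'"]
      by (fastforce simp: B'_def add.commute)
    have "b + e = a + (b - b0)" by (simp add: e_def)
    then have "b + e \<notin> A" using ab(3) by metis
    then have "b \<in> B - B'" using ab(2) by (simp add: B'_def)
    then have "rcount l B' < rcount l B" using rcount_pos[OF l, of "B - B'"] b by auto
    moreover have "a0 \<in> A'" using a0 by (simp add: A'_def)
    ultimately obtain C d where C: "0 < d" "d dvd l" "periodic d C" "a0 + b0 \<in> C" "C \<subseteq> A' + B'"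
      "rcount l A' + rcount l B' \<le> rcount l C + nat (l div d)"
      using less.hyps[OF _ perA' perB' _ b0'] by blast
    have "A' + B' \<subseteq> A + B"
    proof
      fix z assume "z \<in> A' + B'"
      then obtain x y where z: "z = x + y" "x \<in> A'" "y \<in> B'" by (auto simp: set_plus_def)
      show "z \<in> A + B"
      proof (cases "x \<in> A")
        case True
        moreover have "y \<in> B" using z by (simp add: B'_def)
        ultimately show ?thesis using z(1) set_plus_intro by metis
      next
        case False
        then obtain w where "w \<in> B" "x = e + w" using z by (auto simp: A'_def)
        \<comment> \<open>The shift \<open>e\<close> passes from \<open>x\<close> to
          \<open>y\<close>, which moves \<open>y\<close> into \<open>A\<close> and leaves
          \<open>w\<close> in \<open>B\<close>.\<close>
        then have "z = (y + e) + w" "y + e \<in> A" using z by (auto simp: B'_def)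
        then show ?thesis using \<open>w \<in> B\<close> set_plus_intro by metis
      qed
    qed
    then have "C \<subseteq> A + B" using C(5) by blast
    moreover have "rcount l A + rcount l B \<le> rcount l C + nat (l div d)" using C(6) a b by simp
    ultimately show ?thesis using C by blast
  next
    case False
    obtain d where d: "0 < d" "periodic d A" "\<And>p. periodic p A \<Longrightarrow> d dvd p"
      using minimal_period[OF l A] by blast
    have dl: "d dvd l" using d(3) A .
    have "d dvd b - b0" if "b \<in> B" for b
      using False that by (intro d(3) one_sided_periodic[OF l A]) blast
    \<comment> \<open>\<open>B\<close> lies in one class modulo \<open>d\<close>, so it has at most
      \<open>l div d\<close> residues modulo \<open>l\<close>, and the translate of \<open>A\<close>
      by \<open>b0\<close> serves as \<open>C\<close>.\<close>
    then have "(\<lambda>x. x mod d) ` B \<subseteq> {b0 mod d}" by (auto simp: mod_eq_dvd_iff)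
    from card_mono[OF _ this] have "rcount d B \<le> 1" by (simp add: rcount_def)
    then have "nat (l div d) * rcount d B \<le> nat (l div d)" by simp
    then have "rcount l B \<le> nat (l div d)" using rcount_le[OF d(1) dl l, of B] by (rule order.trans[rotated])
    moreover have "rcount l ((+) b0 ` A) = rcount l A" by (rule rcount_translate)
    moreover have "(+) b0 ` A \<subseteq> A + B" using b0 by (auto simp: add.commute)
    moreover have "a0 + b0 \<in> (+) b0 ` A" using a0 by (simp add: mem_translate)
    ultimately show ?thesis using d(1) dl periodic_translate[OF d(2), of b0]
      by (intro exI[of _ "(+) b0 ` A"] exI[of _ d]) simp
  qed
qed

text \<open>Every element of the sumset lies in a piece that satisfies the bound, and finitely many
  pieces may be united.\<close>

lemma kneser_periodic:
  assumes l: "0 < l" and A: "periodic l A" "A \<noteq> {}" and B: "periodic l B" "B \<noteq> {}"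
  obtains d where "0 < d" "d dvd l" "periodic d (A + B)"
    "rcount l A + rcount l B \<le> rcount l (A + B) + nat (l div d)"
proof -
  let ?good = "\<lambda>C d. 0 < d \<and> d dvd l \<and> periodic d C \<and> rcount l A + rcount l B \<le> rcount l C + nat (l div d)"
  have "F \<subseteq> A + B \<longrightarrow> (\<exists>C d. ?good C d \<and> F \<subseteq> C \<and> C \<subseteq> A + B)" if "finite F" "F \<noteq> {}" for F
    using that
  proof (induction rule: finite_ne_induct)
    case (singleton c)
    show ?case
    proof
      assume "{c} \<subseteq> A + B"
      then obtain a b where "c = a + b" "a \<in> A" "b \<in> B" by (auto simp: set_plus_def)
      then show "\<exists>C d. ?good C d \<and> {c} \<subseteq> C \<and> C \<subseteq> A + B"
        using kneser_piece[OF l A(1) B(1)] by (metis empty_subsetI insert_subset)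
    qed
  next
    case (insert c F)
    show ?case
    proof
      assume sub: "insert c F \<subseteq> A + B"
      then obtain a b where ab: "c = a + b" "a \<in> A" "b \<in> B" by (auto simp: set_plus_def)
      obtain C d where C: "?good C d" "c \<in> C" "C \<subseteq> A + B"
        using kneser_piece[OF l A(1) B(1) ab(2,3)] ab(1) by blast
      obtain C' d' where C': "?good C' d'" "F \<subseteq> C'" "C' \<subseteq> A + B" using insert.IH sub by auto
      obtain d'' where "0 < d''" "d'' dvd l" "periodic d'' (C \<union> C')"
          "rcount l A + rcount l B \<le> rcount l (C \<union> C') + nat (l div d'')"
        using periodic_union[OF l, of d C d' C' "rcount l A + rcount l B"] C C' by blast
      then show "\<exists>C d. ?good C d \<and> insert c F \<subseteq> C \<and> C \<subseteq> A + B"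
        using C C' by (intro exI[of _ "C \<union> C'"] exI[of _ d'']) auto
    qed
  qed
  note * = this
  have perAB: "periodic l (A + B)"
  proof (rule periodicI, rule iffI)
    fix x assume "x + l \<in> A + B"
    then obtain a b where ab: "x + l = a + b" "a \<in> A" "b \<in> B" by (auto simp: set_plus_def)
    then have "a - l \<in> A" using periodicD[OF A(1), of "a - l"] by simp
    moreover have "x = (a - l) + b" using ab by simp
    ultimately show "x \<in> A + B" using ab(3) by auto
  next
    fix x assume "x \<in> A + B"
    then obtain a b where ab: "x = a + b" "a \<in> A" "b \<in> B" by (auto simp: set_plus_def)
    then have "a + l \<in> A" using periodicD[OF A(1)] by simp
    moreover have "x + l = (a + l) + b" using ab by simp
    ultimately show "x + l \<in> A + B" using ab(3) set_plus_intro by metis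
  qed
  \<comment> \<open>\<open>?F\<close> represents all classes of the sumset, so an
    \<open>l\<close>-periodic set between \<open>?F\<close> and \<open>A + B\<close> is all of
    \<open>A + B\<close>.\<close>
  let ?F = "(A + B) \<inter> {0..<l}"
  have rep: "x mod l \<in> ?F" if "x \<in> A + B" for x
    using that l periodic_cong[OF perAB, of "x mod l" x] by simp
  moreover have "A + B \<noteq> {}" using A B by (auto simp: set_plus_def)
  ultimately have "?F \<noteq> {}" by blast
  then obtain C d where C: "?good C d" "?F \<subseteq> C" "C \<subseteq> A + B" using *[of ?F] by auto
  have "periodic l C" using C periodic_dvd by blast
  then have "A + B \<subseteq> C"
    using rep C(2) periodic_cong[of l C _ "_ mod l"] by (metis mod_mod_trivial subset_iff)
  then have "C = A + B" using C(3) by blast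
  then show thesis using that C(1) by blast
qed

section \<open>From periodic sets to arbitrary sets of integers\<close>

text \<open>The smallest \<open>l\<close>-periodic superset of \<open>X\<close>; it makes the
  periodic results available for finite sets.\<close>

definition saturate :: "int \<Rightarrow> int set \<Rightarrow> int set" where
  "saturate l X = {x. \<exists>y\<in>X. x mod l = y mod l}"

lemma periodic_saturate: "periodic l (saturate l X)"
  by (simp add: periodic_def saturate_def)

lemma subset_saturate: "X \<subseteq> saturate l X"
  by (auto simp: saturate_def)

lemma residues_saturate:
  assumes "d dvd l" shows "(\<lambda>x. x mod d) ` saturate l X = (\<lambda>x. x mod d) ` X"
proof
  show "(\<lambda>x. x mod d) ` X \<subseteq> (\<lambda>x. x mod d) ` saturate l X" by (intro image_mono subset_saturate)
  show "(\<lambda>x. x mod d) ` saturate l X \<subseteq> (\<lambda>x. x mod d) ` X"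
  proof
    fix z assume "z \<in> (\<lambda>x. x mod d) ` saturate l X"
    then obtain x y where "z = x mod d" "y \<in> X" "x mod l = y mod l" by (auto simp: saturate_def)
    then show "z \<in> (\<lambda>x. x mod d) ` X" using assms by (metis image_eqI mod_mod_cancel)
  qed
qed

lemma rcount_saturate: "d dvd l \<Longrightarrow> rcount d (saturate l X) = rcount d X"
  by (simp add: rcount_def residues_saturate)

lemma saturate_add: "saturate l X + saturate l Y = saturate l (X + Y)"
proof (intro equalityI subsetI)
  fix z assume "z \<in> saturate l X + saturate l Y"
  then obtain x y a b where "z = x + y" "a \<in> X" "b \<in> Y" "x mod l = a mod l" "y mod l = b mod l"
    by (auto simp: saturate_def set_plus_def)
  then have "z mod l = (a + b) mod l" "a + b \<in> X + Y" by (auto intro: mod_add_cong)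
  then show "z \<in> saturate l (X + Y)" by (auto simp: saturate_def)
next
  fix z assume "z \<in> saturate l (X + Y)"
  then obtain a b where ab: "a \<in> X" "b \<in> Y" "z mod l = (a + b) mod l"
    by (auto simp: saturate_def set_plus_def)
  then have "(z - b) mod l = a mod l" by (metis add_diff_cancel_right' mod_diff_left_eq)
  then have "z - b \<in> saturate l X" using ab by (auto simp: saturate_def)
  moreover have "b \<in> saturate l Y" using ab subset_saturate by blast
  ultimately have "(z - b) + b \<in> saturate l X + saturate l Y" by blast
  then show "z \<in> saturate l X + saturate l Y" by simp
qed

lemma saturate_periodic:
  assumes "d dvd l" "periodic d (saturate l X)" shows "saturate d X = saturate l X"
proof (intro equalityI subsetI)
  fix x assume "x \<in> saturate d X"
  then obtain y where "y \<in> X" "x mod d = y mod d" by (auto simp: saturate_def)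
  then show "x \<in> saturate l X" using periodic_cong[OF assms(2)] subset_saturate by blast
next
  fix x assume "x \<in> saturate l X"
  then show "x \<in> saturate d X" using assms(1) by (auto simp: saturate_def) (metis mod_mod_cancel)
qed

text \<open>
  Taking the minimal period \<open>d\<close> as modulus makes the sumset aperiodic, so the subgroup term becomes \<open>1\<close>.
\<close>

theorem kneser_cyclic:
  assumes l: "0 < l" and "A \<noteq> {}" "B \<noteq> {}"
  obtains d where "0 < d" "d dvd l" "periodic d (saturate l (A + B))"
    "rcount d A + rcount d B \<le> rcount d (A + B) + 1"
proof -
  have ne: "saturate m A \<noteq> {}" "saturate m B \<noteq> {}" for m using assms subset_saturate by blast+
  let ?Z = "saturate l (A + B)"
  obtain d where d: "0 < d" "periodic d ?Z" "\<And>p. periodic p ?Z \<Longrightarrow> d dvd p"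
    using minimal_period[OF l periodic_saturate] by blast
  have dl: "d dvd l" using d(3) periodic_saturate .
  have Z: "saturate d (A + B) = ?Z" using saturate_periodic[OF dl d(2)] .
  obtain d' where d': "0 < d'" "d' dvd d" "periodic d' (saturate d A + saturate d B)"
    "rcount d (saturate d A) + rcount d (saturate d B) \<le> rcount d (saturate d A + saturate d B) + nat (d div d')"
    using kneser_periodic[OF d(1) periodic_saturate ne(1) periodic_saturate ne(2)] .
  \<comment> \<open>Minimality of \<open>d\<close> forces \<open>d' = d\<close>, so the subgroup
    term \<open>d div d'\<close> is 1.\<close>
  have "d dvd d'" using d(3) d'(3) Z by (simp add: saturate_add)
  then have "d' = d" using d' d(1) by (metis zdvd_antisym_nonneg order_less_imp_le)
  then show thesis using that[OF d(1) dl d(2)] d'(4) d(1) by (simp add: saturate_add rcount_saturate)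
qed

subsection \<open>The Lev-Smeliansky inequality\<close>

text \<open>The sumset contains \<open>X\<close> shifted by \<open>Min Y\<close>, which ends at
  \<open>Max X + Min Y\<close>, and \<open>Y\<close> shifted by \<open>Max X\<close>, which begins
  there.\<close>

lemma card_sumset_ge:
  fixes X Y :: "int set"
  assumes "finite X" "X \<noteq> {}" "finite Y" "Y \<noteq> {}"
  shows "card X + card Y \<le> card (X + Y) + 1"
proof -
  let ?P = "(+) (Min Y) ` X" and ?Q = "(+) (Max X) ` Y"
  have fin: "finite (X + Y)" using assms by (intro finite_set_plus)
  have "?P \<union> ?Q \<subseteq> X + Y"
    using Min_in[OF assms(3,4)] Max_in[OF assms(1,2)]
    by (auto simp: add.commute[of "Min Y"] intro!: set_plus_intro)
  then have "card (?P \<union> ?Q) \<le> card (X + Y)" using fin by (intro card_mono)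
  moreover have "?P \<inter> ?Q \<subseteq> {Max X + Min Y}"
  proof
    fix z assume "z \<in> ?P \<inter> ?Q"
    then obtain x y where "x \<in> X" "y \<in> Y" "z = Min Y + x" "z = Max X + y" by blast
    then show "z \<in> {Max X + Min Y}" using Max_ge[OF assms(1), of x] Min_le[OF assms(3), of y] by simp
  qed
  then have "card (?P \<inter> ?Q) \<le> 1" using card_mono[of "{Max X + Min Y}"] by fastforce
  moreover have "card ?P = card X" "card ?Q = card Y" by (simp_all add: card_image)
  moreover have "card ?P + card ?Q = card (?P \<union> ?Q) + card (?P \<inter> ?Q)"
    using assms by (intro card_Un_Int) simp_all
  ultimately show ?thesis by linarith
qed

lemma rcount_window:
  assumes "X \<subseteq> {m..<m + l}" shows "rcount l X = card X"
proof -
  have "inj_on (\<lambda>x. x mod l) X"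
  proof (rule inj_onI)
    fix x y assume xy: "x \<in> X" "y \<in> X" "x mod l = y mod l"
    then have "l dvd x - y" by (simp add: mod_eq_dvd_iff)
    moreover have "x \<in> {m..<m + l}" "y \<in> {m..<m + l}" using xy assms by blast+
    then have "\<bar>x - y\<bar> < \<bar>l\<bar>" unfolding atLeastLessThan_iff by linarith
    ultimately show "x = y" using dvd_imp_le_int[of "x - y" l] by linarith
  qed
  then show ?thesis by (simp add: rcount_def card_image)
qed

lemma card_window_le:
  assumes "X \<subseteq> {m..<m + l}" "0 < d" "d dvd l" "0 < l"
  shows "card X \<le> nat (l div d) * rcount d X"
  using rcount_le[OF assms(2-4), of X] rcount_window[OF assms(1)] by simp

text \<open>Dropping the copy of \<open>B\<close> shifted by \<open>l\<close> loses no residue,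
  since \<open>B\<close> itself remains.\<close>

lemma rcount_add_card_le:
  assumes "finite X" "B \<subseteq> X" "(+) l ` B \<subseteq> X" "B \<inter> (+) l ` B = {}"
  shows "rcount l X + card B \<le> card X"
proof -
  have "(\<lambda>x. x mod l) ` (+) l ` B \<subseteq> (\<lambda>x. x mod l) ` (X - (+) l ` B)"
    using assms(2,4) by (auto simp: image_image) blast
  then have "(\<lambda>x. x mod l) ` X = (\<lambda>x. x mod l) ` (X - (+) l ` B)" by blast
  then have "rcount l X \<le> card (X - (+) l ` B)"
    using rcount_le_card[of "X - (+) l ` B" l] assms(1) by (simp add: rcount_def)
  also have "\<dots> = card X - card B"
    using assms(1,3) by (simp add: card_Diff_subset finite_subset card_image)
  finally show ?thesis
    using card_mono[OF assms(1,2)] by linarith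
qed

lemma rcount_remove_class:
  assumes "0 < d" "x \<in> X"
  shows "rcount d X = rcount d {y \<in> X. y mod d \<noteq> x mod d} + 1"
proof -
  have "(\<lambda>x. x mod d) ` X = insert (x mod d) ((\<lambda>x. x mod d) ` {y \<in> X. y mod d \<noteq> x mod d})"
    using assms(2) by auto
  moreover have "x mod d \<notin> (\<lambda>x. x mod d) ` {y \<in> X. y mod d \<noteq> x mod d}" by auto
  ultimately show ?thesis using finite_residues[OF assms(1)] by (simp add: rcount_def)
qed

text \<open>Each of the other \<open>rcount d X - 1\<close> classes holds at most
  \<open>l div d\<close> elements of the window.\<close>

lemma card_class_window:
  assumes X: "X \<subseteq> {m..<m + l}" and d: "0 < d" "d dvd l" "0 < l" and x: "x \<in> X"
  shows "card X + nat (l div d) \<le> card {y \<in> X. y mod d = x mod d} + nat (l div d) * rcount d X"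
proof -
  have fin: "finite X" using X finite_subset by blast
  let ?C = "{y \<in> X. y mod d = x mod d}" and ?D = "{y \<in> X. y mod d \<noteq> x mod d}"
  have "card X = card ?C + card ?D"
    using fin by (subst card_Un_disjoint[symmetric]) (auto intro: arg_cong[where f = card])
  moreover have "card ?D \<le> nat (l div d) * rcount d ?D"
    using X by (intro card_window_le[OF _ d, of _ m]) blast
  ultimately show ?thesis using rcount_remove_class[OF d(1) x] by simp
qed

text \<open>
  Every element of \<open>B\<close> gives a residue modulo \<open>l\<close> with two representatives \<open>b\<close> and \<open>b + l\<close> in \<open>A + B\<close>. If
  the period \<open>d\<close> from Kneser's theorem is not \<open>1\<close>, some class modulo \<open>d\<close> meets \<open>A + B\<close> but not \<open>B\<close>; in that
  class the sumset bound for integers replaces the count of residues.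
\<close>

theorem lev_smeliansky:
  fixes A B :: "int set"
  assumes fin: "finite A" and A: "A \<subseteq> {0..l}" "0 \<in> A" "l \<in> A" and l: "0 < l" and gcd: "Gcd A = 1"
    and B: "B \<noteq> {}" "B \<subseteq> {m..<m + l}"
  shows "l + int (card B) \<le> int (card (A + B)) \<or> card A + 2 * card B \<le> card (A + B) + 2"
proof -
  have finB: "finite B" using B(2) finite_subset by blast
  have finAB: "finite (A + B)" using fin finB by (intro finite_set_plus)
  have shift: "B \<subseteq> A + B" "(+) l ` B \<subseteq> A + B"
    using A set_plus_intro[of 0 A _ B] by force+
  have disj: "B \<inter> (+) l ` B = {}"
  proof (rule ccontr)
    assume "\<not> ?thesis"
    then obtain x where "x \<in> B" "l + x \<in> B" by blast
    then have "x \<in> {m..<m + l}" "l + x \<in> {m..<m + l}" using B(2) by blast+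
    then show False by simp
  qed
  obtain d where d: "0 < d" "d dvd l" "periodic d (saturate l (A + B))"
    "rcount d A + rcount d B \<le> rcount d (A + B) + 1"
    using kneser_cyclic[OF l, of A B] A B by blast
  let ?q = "nat (l div d)"
  have total: "rcount l (A + B) = ?q * rcount d (A + B)"
    using rcount_periodic[OF d(1,2) l d(3)] d(2) by (simp add: rcount_saturate)
  show ?thesis
  proof (cases "d = 1")
    case True
    \<comment> \<open>A nonempty sumset whose saturation has period 1 meets all \<open>l\<close>
      residues.\<close>
    have "0 < rcount d (A + B)" using d(1) shift(1) B(1) by (intro rcount_pos) blast+
    then have "?q \<le> rcount l (A + B)" unfolding total by simp
    then have "l \<le> int (rcount l (A + B))" using True by simp
    then show ?thesis using rcount_add_card_le[OF finAB shift disj] by linarith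
  next
    case False
    \<comment> \<open>As \<open>0 \<in> A\<close>, a single class would make \<open>d\<close> divide
      all of \<open>A\<close>. With at least two classes in \<open>A\<close>, Kneser's bound gives
      \<open>A + B\<close> more classes than \<open>B\<close>.\<close>
    have "rcount d A \<noteq> 1"
    proof
      assume "rcount d A = 1"
      then obtain c where c: "(\<lambda>x. x mod d) ` A = {c}" unfolding rcount_def by (metis card_1_singletonE)
      have "d dvd x" if "x \<in> A" for x
      proof -
        have "x mod d \<in> {c}" "0 mod d \<in> {c}" unfolding c[symmetric] using that A(2) by (blast intro: imageI)+
        then show ?thesis by (simp add: dvd_eq_mod_eq_0)
      qed
      then have "d dvd Gcd A" by (rule Gcd_greatest)
      then show False using gcd False d(1) by simp
    qed
    moreover have "0 < rcount d A" using rcount_pos[OF d(1)] A(2) by blast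
    ultimately have "rcount d B < rcount d (A + B)" using d(4) by linarith
    then have "\<not> (\<lambda>x. x mod d) ` (A + B) \<subseteq> (\<lambda>x. x mod d) ` B"
      unfolding rcount_def using card_mono[OF finite_residues[OF d(1), of B]] by (meson linorder_not_less)
    then obtain a b where ab: "a \<in> A" "b \<in> B" "(a + b) mod d \<notin> (\<lambda>x. x mod d) ` B"
      by (auto simp: set_plus_def)
    define X where "X = {x \<in> A + B. x mod d \<noteq> (a + b) mod d}"
    define Z where "Z = {x \<in> A + B. x mod d = (a + b) mod d}"
    let ?Aa = "{x \<in> A. x mod d = a mod d}" and ?Bb = "{x \<in> B. x mod d = b mod d}"
    have XZ: "A + B = X \<union> Z" "X \<inter> Z = {}" by (auto simp: X_def Z_def)
    have finXZ: "finite X" "finite Z" using finAB by (simp_all add: X_def Z_def)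
    have card: "card (A + B) = card X + card Z"
      unfolding XZ(1) by (rule card_Un_disjoint[OF finXZ XZ(2)])
    have "?Aa + ?Bb \<subseteq> Z"
    proof
      fix z assume "z \<in> ?Aa + ?Bb"
      then obtain x y where "z = x + y" "x \<in> ?Aa" "y \<in> ?Bb" by (rule set_plus_elim)
      then show "z \<in> Z" unfolding Z_def by (auto intro: mod_add_cong)
    qed
    then have "card (?Aa + ?Bb) \<le> card Z" using finXZ by (intro card_mono)
    moreover have "card ?Aa + card ?Bb \<le> card (?Aa + ?Bb) + 1"
      using fin finB ab by (intro card_sumset_ge) auto
    ultimately have cardZ: "card ?Aa + card ?Bb \<le> card Z + 1" by linarith
    have "B \<subseteq> X" "(+) l ` B \<subseteq> X"
    proof -
      show *: "B \<subseteq> X" using shift(1) ab(3) unfolding X_def by (fastforce intro: rev_image_eqI)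
      have "(l + x) mod d = x mod d" for x using d(2) by (metis dvd_eq_mod_eq_0 mod_add_left_eq add_0)
      then show "(+) l ` B \<subseteq> X" using shift(2) * by (auto simp: X_def)
    qed
    then have cardX: "rcount l X + card B \<le> card X"
      using rcount_add_card_le[OF finXZ(1)] disj by blast
    have "rcount d Z = 1"
    proof -
      have "(\<lambda>x. x mod d) ` Z = {(a + b) mod d}" using ab by (auto simp: Z_def)
      then show ?thesis by (simp add: rcount_def)
    qed
    then have "rcount l Z \<le> ?q" using rcount_le[OF d(1,2) l, of Z] by simp
    then have countX: "?q * rcount d (A + B) \<le> rcount l X + ?q"
      using rcount_Un_le[of l X Z] total XZ(1) by simp
    have cardA: "card A + ?q \<le> card ?Aa + ?q * rcount d A + 1"
    proof -
      \<comment> \<open>Removing \<open>l\<close> fits \<open>A\<close> into a half-open window and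
        costs the 1 in \<open>cardA\<close>; the congruent element \<open>0\<close> keeps the class
        of \<open>l\<close> occupied.\<close>
      let ?A' = "A - {l}"
      have A': "?A' \<subseteq> {0..<0 + l}" using A(1) by force
      obtain a' where a': "a' \<in> ?A'" "a' mod d = a mod d"
      proof
        show "(if a = l then 0 else a) \<in> ?A'" using A(2) ab(1) l by simp
        show "(if a = l then 0 else a) mod d = a mod d" using d(2) by simp
      qed
      have "card ?A' + ?q \<le> card {y \<in> ?A'. y mod d = a mod d} + ?q * rcount d ?A'"
        using card_class_window[OF A' d(1,2) l a'(1)] a'(2) by simp
      moreover have "card {y \<in> ?A'. y mod d = a mod d} \<le> card ?Aa" using fin by (intro card_mono) auto
      moreover have "?q * rcount d ?A' \<le> ?q * rcount d A" using d(1) by (intro mult_le_mono2 rcount_mono) auto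
      moreover have "card A = card ?A' + 1" using fin A(3) by (metis Suc_eq_plus1 card_Suc_Diff1)
      ultimately show ?thesis by linarith
    qed
    have cardB: "card B + ?q \<le> card ?Bb + ?q * rcount d B"
      using card_class_window[OF B(2) d(1,2) l ab(2)] .
    \<comment> \<open>In the sum of all bounds the multiples of \<open>?q\<close> amount to
      \<open>?q\<close> times the slack in Kneser's bound. The 2 in the claim is one unit from
      \<open>cardZ\<close> and one from \<open>cardA\<close>.\<close>
    have "?q * (rcount d A + rcount d B) \<le> ?q * (rcount d (A + B) + 1)"
      using d(4) by (rule mult_le_mono2)
    then have "?q * rcount d A + ?q * rcount d B \<le> ?q * rcount d (A + B) + ?q"
      by (simp add: distrib_left)
    then show ?thesis using card cardZ cardX countX cardA cardB by linarith
  qed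
qed

subsection \<open>The sumset of \<open>A\<close> and its dilate\<close>

lemma card_dilate_sum:
  fixes A :: "int set"
  assumes fin: "finite A" and A: "A \<subseteq> {0..l}" "0 \<in> A" "l \<in> A" and l: "0 < l" and gcd: "Gcd A = 1"
  shows "l + 2 * int (card A) - 1 \<le> int (card (A + (*) 2 ` A)) \<or> 4 * card A \<le> card (A + (*) 2 ` A) + 4"
proof -
  define E where "E = {x. 2 * x \<in> A}"
  define D where "D = {x. 2 * x + 1 \<in> A}"
  have AED: "A = (*) 2 ` E \<union> (\<lambda>x. 2 * x + 1) ` D"
  proof (intro equalityI subsetI)
    fix x assume "x \<in> A"
    show "x \<in> (*) 2 ` E \<union> (\<lambda>x. 2 * x + 1) ` D"
    proof (cases "even x")
      case True
      then show ?thesis using \<open>x \<in> A\<close> by (auto simp: E_def elim!: evenE)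
    next
      case False
      then show ?thesis using \<open>x \<in> A\<close> by (auto simp: D_def elim!: oddE)
    qed
  qed (auto simp: E_def D_def)
  have win: "E \<subseteq> {0..<0 + l}" "D \<subseteq> {0..<0 + l}" using A(1) l by (fastforce simp: E_def D_def)+
  then have finED: "finite E" "finite D" using finite_subset by blast+
  have inj: "inj ((*) (2::int))" "inj (\<lambda>x::int. 2 * x + 1)" by (auto simp: inj_def)
  have disj: "(*) 2 ` P \<inter> (\<lambda>x. 2 * x + 1) ` Q = {}" for P Q :: "int set" by (auto, presburger)
  have cardP: "card ((*) 2 ` P \<union> (\<lambda>x. 2 * x + 1) ` Q) = card P + card Q" if "finite P" "finite Q" for P Q :: "int set"
    using that disj card_image[OF inj_on_subset[OF inj(1) subset_UNIV]] card_image[OF inj_on_subset[OF inj(2) subset_UNIV]]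
    by (subst card_Un_disjoint) simp_all
  have k: "card A = card E + card D" by (subst AED) (rule cardP[OF finED])
  \<comment> \<open>The parity of \<open>x + 2 * y\<close> is that of \<open>x\<close>, so the half
    of \<open>x\<close>, rounded down, decides between \<open>E\<close> and
    \<open>D\<close>.\<close>
  have "A + (*) 2 ` A = (*) 2 ` (A + E) \<union> (\<lambda>x. 2 * x + 1) ` (A + D)"
  proof (intro equalityI subsetI)
    fix z assume "z \<in> A + (*) 2 ` A"
    then obtain x y where z: "z = x + 2 * y" "x \<in> A" "y \<in> A" by (auto simp: set_plus_def)
    then consider w where "w \<in> E" "x = 2 * w" | w where "w \<in> D" "x = 2 * w + 1" using AED by blast
    then show "z \<in> (*) 2 ` (A + E) \<union> (\<lambda>x. 2 * x + 1) ` (A + D)"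
    proof cases
      case 1
      then have "z = 2 * (y + w)" using z by simp
      then show ?thesis using set_plus_intro[OF z(3) 1(1)] by blast
    next
      case 2
      then have "z = 2 * (y + w) + 1" using z by simp
      then show ?thesis using set_plus_intro[OF z(3) 2(1)] by blast
    qed
  next
    fix z assume "z \<in> (*) 2 ` (A + E) \<union> (\<lambda>x. 2 * x + 1) ` (A + D)"
    then consider y w where "y \<in> A" "w \<in> E" "z = 2 * (y + w)" | y w where "y \<in> A" "w \<in> D" "z = 2 * (y + w) + 1"
      unfolding set_plus_def by blast
    then show "z \<in> A + (*) 2 ` A"
    proof cases
      case 1
      then have "z = 2 * w + 2 * y" "2 * w \<in> A" by (simp_all add: E_def)
      then show ?thesis using 1(1) set_plus_intro by blast
    next
      case 2
      then have "z = (2 * w + 1) + 2 * y" "2 * w + 1 \<in> A" by (simp_all add: D_def)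
      then show ?thesis using 2(1) set_plus_intro by blast
    qed
  qed
  then have T: "card (A + (*) 2 ` A) = card (A + E) + card (A + D)"
    using cardP finite_set_plus[OF fin] finED by simp
  have E: "E \<noteq> {}" using A(2) by (auto simp: E_def intro!: exI[of _ 0])
  have D: "D \<noteq> {}"
  proof
    assume "D = {}"
    then have "even x" if "x \<in> A" for x using that AED by auto
    then have "2 dvd Gcd A" by (intro Gcd_greatest)
    then show False using gcd by simp
  qed
  \<comment> \<open>If the first alternative of \<open>lev_smeliansky\<close> holds for
    \<open>E\<close> or for \<open>D\<close>, this plain bound for the other set already yields
    \<open>l + 2 * card A - 1\<close>; otherwise the two second alternatives add up to
    \<open>4 * card A - 4\<close>.\<close>
  have "card A + card E \<le> card (A + E) + 1" "card A + card D \<le> card (A + D) + 1"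
    using card_sumset_ge[OF fin _ finED(1) E] card_sumset_ge[OF fin _ finED(2) D] A(2) by blast+
  then show ?thesis
    using lev_smeliansky[OF fin A l gcd E win(1)] lev_smeliansky[OF fin A l gcd D win(2)] k T by linarith
qed

subsection \<open>The group \<open>BS(1,2)\<close>\<close>

text \<open>Conjugation by \<open>b\<close> carries \<open>a\<close> to \<open>c\<close> and
  respects integer powers.\<close>

lemma (in group) int_pow_intertwine:
  assumes "a \<in> carrier G" "b \<in> carrier G" "c \<in> carrier G" and rel: "a \<otimes> b = b \<otimes> c"
  shows "a [^] (x::int) \<otimes> b = b \<otimes> c [^] x"
proof -
  have nat: "a [^] n \<otimes> b = b \<otimes> c [^] n" for n :: nat
  proof (induction n)
    case (Suc n)
    have "a [^] Suc n \<otimes> b = a [^] n \<otimes> (b \<otimes> c)" using assms by (simp add: m_assoc)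
    also have "\<dots> = (a [^] n \<otimes> b) \<otimes> c" using assms by (simp add: m_assoc)
    also have "\<dots> = b \<otimes> c [^] Suc n" using Suc assms by (simp add: m_assoc)
    finally show ?case .
  qed (use assms in simp)
  show ?thesis
  proof (cases x rule: int_cases2)
    case (nonneg n)
    then show ?thesis using nat by (simp add: int_pow_int)
  next
    case (nonpos n)
    have "inv (a [^] n) \<otimes> b = inv (a [^] n) \<otimes> (b \<otimes> c [^] n) \<otimes> inv (c [^] n)"
      using assms by (simp add: m_assoc)
    also have "\<dots> = inv (a [^] n) \<otimes> (a [^] n \<otimes> b) \<otimes> inv (c [^] n)" using nat by simp
    also have "\<dots> = b \<otimes> inv (c [^] n)" using assms by (simp add: m_assoc[symmetric])
    finally show ?thesis using nonpos assms by (simp add: int_pow_neg_int)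
  qed
qed

text \<open>The action of \<open>BS(1,2)\<close> on \<open>\<rat>\<close> by \<open>a = (x \<mapsto> x + 1)\<close> and \<open>b = (x \<mapsto> x / 2)\<close>.\<close>

fun letter_map :: "bs_generator letter \<Rightarrow> rat \<Rightarrow> rat" where
  "letter_map (Gen Gen_a) x = x + 1"
| "letter_map (Inv_Gen Gen_a) x = x - 1"
| "letter_map (Gen Gen_b) x = x / 2"
| "letter_map (Inv_Gen Gen_b) x = 2 * x"

lemma letter_map_inverse:
  "letter_map (Gen g) (letter_map (Inv_Gen g) x) = x" "letter_map (Inv_Gen g) (letter_map (Gen g) x) = x"
  by (cases g; simp)+

text \<open>Both sides of the defining relation act as x \<mapsto> x / 2 + 1, so the action is well
  defined on classes of words.\<close>

lemma word_cong_imp_foldr_letter_map: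
  "(v, w) \<in> word_cong bs12_relations \<Longrightarrow> foldr letter_map v x = foldr letter_map w x"
proof (induction arbitrary: x rule: word_cong.induct)
  case (relation u v)
  then show ?case by (simp add: bs12_relations_def field_simps)
qed (simp_all add: letter_map_inverse)

interpretation BS: group BS12
  by (rule group_BS12)

lemma bs_a_nat_pow: "bs_a [^]\<^bsub>BS12\<^esub> (n::nat) = word_class bs12_relations (replicate n (Gen Gen_a))"
proof (induction n)
  case (Suc n)
  then show ?case
    by (simp add: BS12_def bs_a_def mult_presented_group replicate_append_same)
qed (simp add: BS12_def one_presented_group)

text \<open>The \<open>n\<close>-th power of \<open>bs_a\<close> moves 0 to
  \<open>n\<close>.\<close>

lemma bs_a_nat_pow_eq_one:
  assumes "bs_a [^]\<^bsub>BS12\<^esub> (n::nat) = \<one>\<^bsub>BS12\<^esub>" shows "n = 0"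
proof -
  have "(replicate n (Gen Gen_a), []) \<in> word_cong bs12_relations"
    using assms unfolding bs_a_nat_pow by (simp add: BS12_def one_presented_group word_class_eq_iff)
  then have "foldr letter_map (replicate n (Gen Gen_a)) 0 = 0"
    using word_cong_imp_foldr_letter_map by fastforce
  moreover have "foldr letter_map (replicate m (Gen Gen_a)) 0 = of_nat m" for m
    by (induction m) simp_all
  ultimately show ?thesis by simp
qed

lemma inj_bs_a_int_pow: "inj (\<lambda>x::int. bs_a [^]\<^bsub>BS12\<^esub> x)"
proof (rule linorder_injI)
  fix x y :: int assume "x < y"
  show "bs_a [^]\<^bsub>BS12\<^esub> x \<noteq> bs_a [^]\<^bsub>BS12\<^esub> y"
  proof
    assume eq: "bs_a [^]\<^bsub>BS12\<^esub> x = bs_a [^]\<^bsub>BS12\<^esub> y"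
    have "bs_a [^]\<^bsub>BS12\<^esub> y = bs_a [^]\<^bsub>BS12\<^esub> x \<otimes>\<^bsub>BS12\<^esub> bs_a [^]\<^bsub>BS12\<^esub> (y - x)"
      using BS.int_pow_mult[OF bs_generators_in_carrier(1), of x "y - x"] by simp
    then have "bs_a [^]\<^bsub>BS12\<^esub> (y - x) = \<one>\<^bsub>BS12\<^esub>"
      using eq bs_generators_in_carrier by (metis BS.int_pow_closed BS.l_cancel_one')
    moreover have "y - x = int (nat (y - x))" using \<open>x < y\<close> by simp
    ultimately have "bs_a [^]\<^bsub>BS12\<^esub> nat (y - x) = \<one>\<^bsub>BS12\<^esub>" by (metis int_pow_int)
    then show False using bs_a_nat_pow_eq_one \<open>x < y\<close> by fastforce
  qed
qed

lemma inj_bs_mult_a_pow: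
  assumes "g \<in> carrier BS12" shows "inj (\<lambda>x::int. g \<otimes>\<^bsub>BS12\<^esub> bs_a [^]\<^bsub>BS12\<^esub> x)"
  using inj_bs_a_int_pow assms bs_generators_in_carrier unfolding inj_def by simp

lemma inj_ba_pow: "inj ba_pow"
  using inj_bs_mult_a_pow[OF bs_generators_in_carrier(2)] by (simp add: inj_def ba_pow_def)

text \<open>Moving the second \<open>bs_b\<close> to the left past a power of \<open>bs_a\<close>
  doubles the exponent.\<close>

lemma ba_pow_mult: "ba_pow x \<otimes>\<^bsub>BS12\<^esub> ba_pow y = (bs_b \<otimes>\<^bsub>BS12\<^esub> bs_b) \<otimes>\<^bsub>BS12\<^esub> bs_a [^]\<^bsub>BS12\<^esub> (y + 2 * x)"
proof -
  note car = bs_generators_in_carrier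
  have "bs_a [^]\<^bsub>BS12\<^esub> x \<otimes>\<^bsub>BS12\<^esub> bs_b = bs_b \<otimes>\<^bsub>BS12\<^esub> (bs_a [^]\<^bsub>BS12\<^esub> (2::nat)) [^]\<^bsub>BS12\<^esub> x"
    using car bs12_relation by (intro BS.int_pow_intertwine) simp_all
  also have "(bs_a [^]\<^bsub>BS12\<^esub> (2::nat)) [^]\<^bsub>BS12\<^esub> x = bs_a [^]\<^bsub>BS12\<^esub> (2 * x)"
    using BS.int_pow_pow[OF car(1), of 2 x] int_pow_int[of BS12 bs_a 2] by (simp add: mult.commute)
  finally have *: "bs_a [^]\<^bsub>BS12\<^esub> x \<otimes>\<^bsub>BS12\<^esub> bs_b = bs_b \<otimes>\<^bsub>BS12\<^esub> bs_a [^]\<^bsub>BS12\<^esub> (2 * x)" .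
  have "ba_pow x \<otimes>\<^bsub>BS12\<^esub> ba_pow y =
      bs_b \<otimes>\<^bsub>BS12\<^esub> (bs_a [^]\<^bsub>BS12\<^esub> x \<otimes>\<^bsub>BS12\<^esub> bs_b) \<otimes>\<^bsub>BS12\<^esub> bs_a [^]\<^bsub>BS12\<^esub> y"
    using car by (simp add: ba_pow_def BS.m_assoc)
  also have "\<dots> = (bs_b \<otimes>\<^bsub>BS12\<^esub> bs_b) \<otimes>\<^bsub>BS12\<^esub> (bs_a [^]\<^bsub>BS12\<^esub> (2 * x) \<otimes>\<^bsub>BS12\<^esub> bs_a [^]\<^bsub>BS12\<^esub> y)"
    unfolding * using car by (simp add: BS.m_assoc)
  also have "bs_a [^]\<^bsub>BS12\<^esub> (2 * x) \<otimes>\<^bsub>BS12\<^esub> bs_a [^]\<^bsub>BS12\<^esub> y = bs_a [^]\<^bsub>BS12\<^esub> (y + 2 * x)"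
    using BS.int_pow_mult[OF car(1), of "2 * x" y] by (simp add: add.commute)
  finally show ?thesis .
qed

lemma card_ba_set: "card (ba_set A) = card A"
  unfolding ba_set_def by (intro card_image inj_on_subset[OF inj_ba_pow]) simp

lemma card_ba_set_square: "card (ba_set A <#>\<^bsub>BS12\<^esub> ba_set A) = card (A + (*) 2 ` A)"
proof -
  let ?f = "\<lambda>z. (bs_b \<otimes>\<^bsub>BS12\<^esub> bs_b) \<otimes>\<^bsub>BS12\<^esub> bs_a [^]\<^bsub>BS12\<^esub> z"
  have "ba_set A <#>\<^bsub>BS12\<^esub> ba_set A = ?f ` (A + (*) 2 ` A)"
  proof (intro equalityI subsetI)
    fix g assume "g \<in> ba_set A <#>\<^bsub>BS12\<^esub> ba_set A"
    then obtain x y where "x \<in> A" "y \<in> A" "g = ba_pow x \<otimes>\<^bsub>BS12\<^esub> ba_pow y"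
      unfolding set_mult_def ba_set_def by blast
    then show "g \<in> ?f ` (A + (*) 2 ` A)" unfolding ba_pow_mult by (blast intro: set_plus_intro)
  next
    fix g assume "g \<in> ?f ` (A + (*) 2 ` A)"
    then obtain x y where "x \<in> A" "y \<in> A" "g = ?f (y + 2 * x)"
      unfolding set_plus_def by blast
    then show "g \<in> ba_set A <#>\<^bsub>BS12\<^esub> ba_set A"
      unfolding set_mult_def ba_set_def ba_pow_mult[symmetric] by blast
  qed
  moreover have "inj_on ?f (A + (*) 2 ` A)"
    using bs_generators_in_carrier by (intro inj_on_subset[OF inj_bs_mult_a_pow]) simp_all
  ultimately show ?thesis by (simp add: card_image)
qed

subsection \<open>Normalisation and conclusion\<close>

lemma normalise:
  fixes A :: "int set"
  assumes fin: "finite A" and k: "2 \<le> card A"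
  obtains A' where "finite A'" "A = (\<lambda>i. Min A + i * diff_gcd A) ` A'" "\<And>i. i \<in> A' \<Longrightarrow> 0 \<le> i"
    "0 \<in> A'" "Gcd A' = 1" "0 < diff_gcd A"
proof -
  define u where "u = Min A"
  define d where "d = diff_gcd A"
  have u: "u \<in> A" "\<And>x. x \<in> A \<Longrightarrow> u \<le> x" using fin k by (auto simp: u_def intro!: Min_in)
  have dvd: "d dvd x - u" if "x \<in> A" for x
    using that unfolding d_def diff_gcd_def u_def by (cases "x = Min A") (auto intro: Gcd_dvd)
  have "\<not> A \<subseteq> {u}" using k card_mono[of "{u}" A] by fastforce
  then obtain v where v: "v \<in> A" "v \<noteq> u" by blast
  have d: "0 < d"
  proof -
    have "d \<noteq> 0" using dvd[OF v(1)] v(2) by auto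
    moreover have "0 \<le> d" by (simp add: d_def diff_gcd_def)
    ultimately show ?thesis by simp
  qed
  define A' where "A' = (\<lambda>x. (x - u) div d) ` A"
  have eq: "u + (x - u) div d * d = x" if "x \<in> A" for x using dvd[OF that] by simp
  have A: "A = (\<lambda>i. u + i * d) ` A'" unfolding A'_def image_image using eq by simp
  have "Gcd A' dvd 1"
  proof -
    \<comment> \<open>The product divides every difference, hence their gcd \<open>d\<close>;
      cancelling \<open>d\<close> leaves a divisor of 1.\<close>
    have "Gcd A' * d dvd d"
      unfolding d_def diff_gcd_def
    proof (rule Gcd_greatest, fold diff_gcd_def d_def u_def)
      fix y assume "y \<in> (\<lambda>x. x - u) ` (A - {u})"
      then obtain x where x: "x \<in> A" "y = x - u" by blast
      then have "Gcd A' dvd (x - u) div d" unfolding A'_def by (intro Gcd_dvd imageI)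
      then have "Gcd A' * d dvd (x - u) div d * d" by (rule mult_dvd_mono) simp
      then show "Gcd A' * d dvd y" using dvd[OF x(1)] x(2) by simp
    qed
    then show ?thesis using d by simp
  qed
  then have "Gcd A' = 1" by simp
  moreover have "0 \<in> A'" unfolding A'_def using u(1) by force
  moreover have "0 \<le> i" if "i \<in> A'" for i
    using that u(2) d by (auto simp: A'_def pos_imp_zdiv_nonneg_iff)
  moreover have "finite A'" using fin by (simp add: A'_def)
  ultimately show thesis using that A d unfolding u_def d_def by blast
qed

lemma inj_affine: "0 < d \<Longrightarrow> inj (\<lambda>i. u + i * (d::int))"
  by (simp add: inj_def)

lemma card_dilate_sum_affine:
  fixes d :: int
  assumes "0 < d"
  shows "card ((\<lambda>i. u + i * d) ` A + (*) 2 ` (\<lambda>i. u + i * d) ` A) = card (A + (*) 2 ` A)"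
proof -
  have "(\<lambda>i. u + i * d) ` A + (*) 2 ` (\<lambda>i. u + i * d) ` A = (\<lambda>i. 3 * u + i * d) ` (A + (*) 2 ` A)"
  proof (intro equalityI subsetI)
    fix z assume "z \<in> (\<lambda>i. u + i * d) ` A + (*) 2 ` (\<lambda>i. u + i * d) ` A"
    then obtain i j where ij: "i \<in> A" "j \<in> A" "z = (u + i * d) + 2 * (u + j * d)"
      unfolding set_plus_def by blast
    then have "z = 3 * u + (i + 2 * j) * d" by (simp add: algebra_simps)
    then show "z \<in> (\<lambda>i. 3 * u + i * d) ` (A + (*) 2 ` A)" using ij by (blast intro: set_plus_intro)
  next
    fix z assume "z \<in> (\<lambda>i. 3 * u + i * d) ` (A + (*) 2 ` A)"
    then obtain i j where ij: "i \<in> A" "j \<in> A" "z = 3 * u + (i + 2 * j) * d"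
      unfolding set_plus_def by blast
    then have "z = (u + i * d) + 2 * (u + j * d)" by (simp add: algebra_simps)
    then show "z \<in> (\<lambda>i. u + i * d) ` A + (*) 2 ` (\<lambda>i. u + i * d) ` A" using ij by (blast intro: set_plus_intro)
  qed
  then show ?thesis
    using card_image[OF inj_on_subset[OF inj_affine[OF assms]]] by simp
qed

lemma progression_eq_image:
  "{ba_pow (u + i * d) | i. 0 \<le> i \<and> i \<le> n} = ba_pow ` (\<lambda>i. u + i * d) ` {0..n}"
  by (auto simp: image_image)

text \<open>\<open>l\<close> is the largest element of the normalised set, so \<open>l + 1\<close>
  counts the terms of the shortest progression with difference \<open>diff_gcd A\<close> around
  \<open>A\<close>.\<close>

lemma progression_cover:
  fixes A :: "int set"
  assumes fin: "finite A" and k: "2 \<le> card A"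
  obtains l where "A \<subseteq> (\<lambda>i. Min A + i * diff_gcd A) ` {0..l}" "int (card A) \<le> l + 1" "0 < diff_gcd A" "card A = 2 \<Longrightarrow> l = 1"
    "l + 2 * int (card A) - 1 \<le> int (card (A + (*) 2 ` A)) \<or> 4 * card A \<le> card (A + (*) 2 ` A) + 4"
proof -
  obtain A' where A': "finite A'" "A = (\<lambda>i. Min A + i * diff_gcd A) ` A'" "\<And>i. i \<in> A' \<Longrightarrow> 0 \<le> i"
    "0 \<in> A'" "Gcd A' = 1" and d: "0 < diff_gcd A"
    by (rule normalise[OF fin k]) blast
  define l where "l = Max A'"
  have l: "A' \<subseteq> {0..l}" "l \<in> A'"
  proof -
    have "A' \<noteq> {}" using A'(4) by blast
    then show "l \<in> A'" unfolding l_def by (rule Max_in[OF A'(1)])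
    show "A' \<subseteq> {0..l}" using A'(1,3) by (auto simp: l_def)
  qed
  have card: "card A = card A'" by (subst A'(2)) (intro card_image inj_on_subset[OF inj_affine[OF d]] subset_UNIV)
  have le: "int (card A) \<le> l + 1" using card_mono[OF _ l(1)] card A'(3)[OF l(2)] by simp
  then have "0 < l" using k by linarith
  from card_dilate_sum[OF A'(1) l(1) A'(4) l(2) this A'(5)]
  have "l + 2 * int (card A) - 1 \<le> int (card (A + (*) 2 ` A)) \<or> 4 * card A \<le> card (A + (*) 2 ` A) + 4"
    unfolding card card_dilate_sum_affine[OF d, of "Min A" A', folded A'(2)] .
  moreover have "A \<subseteq> (\<lambda>i. Min A + i * diff_gcd A) ` {0..l}" using A'(2) l(1) by blast
  \<comment> \<open>The normalised set is \<open>{0, l}\<close>, whose gcd is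
    \<open>l\<close>.\<close>
  moreover have "l = 1" if "card A = 2"
  proof -
    have "{0, l} = A'"
      using card_subset_eq[OF A'(1), of "{0, l}"] A'(4) l(2) \<open>0 < l\<close> that card by simp
    then show ?thesis using A'(5) \<open>0 < l\<close> by force
  qed
  ultimately show thesis using that le d by blast
qed

theorem theorem5:
  fixes A :: "int set" and k :: nat and S S2 :: "bs_generator word set set" and u d :: int
  assumes "finite A" and "card A = k" and "k \<ge> 1"
    and "S = ba_set A"
    and "S2 = S <#>\<^bsub>BS12\<^esub> S"
    and "u = Min A" and "d = diff_gcd A"
  shows "card S = k
    \<and> int (card S2) \<ge> 3 * int k - 2
    \<and> (\<forall>h::int.
         k \<ge> 3 \<and> int (card S2) = (3 * int k - 2) + h \<and> int (card S2) < 4 * int (card S) - 4 \<longrightarrow>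
           h \<ge> 0
           \<and> S \<subseteq> {ba_pow (u + i * d) | i. 0 \<le> i \<and> i \<le> int k + h - 1}
           \<and> int (card {ba_pow (u + i * d) | i. 0 \<le> i \<and> i \<le> int k + h - 1}) = int k + h
           \<and> int k + h \<le> 2 * int k - 3)
    \<and> ((1 \<le> k \<and> k \<le> 2) \<or> (k \<ge> 3 \<and> int (card S2) = 3 * int k - 2) \<longrightarrow>
         S = {ba_pow (u + i * d) | i. 0 \<le> i \<and> i \<le> int k - 1})"
proof -
  have S: "card S = k" "card S2 = card (A + (*) 2 ` A)"
    using assms by (simp_all add: card_ba_set card_ba_set_square)
  show ?thesis
  proof (cases "k = 1")
    case True
    then obtain a where "A = {a}" using assms(2) card_1_singletonE by blast
    then have "A = {u}" using assms(6) by simp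
    moreover from this have "A + (*) 2 ` A = {3 * u}" by (auto simp: set_plus_def)
    ultimately show ?thesis
      using True S assms(4) unfolding progression_eq_image by (simp add: ba_set_def)
  next
    case False
    then have k: "2 \<le> card A" using assms(2,3) by simp
    obtain l where A: "A \<subseteq> (\<lambda>i. u + i * d) ` {0..l}" and le: "int k \<le> l + 1" and d: "0 < d"
      and two: "k = 2 \<Longrightarrow> l = 1" and T: "l + 2 * int k - 1 \<le> int (card S2) \<or> 4 * k \<le> card S2 + 4"
      using progression_cover[OF assms(1) k] unfolding assms(2) S assms(6,7)[symmetric] by blast
    \<comment> \<open>The first alternative is used with \<open>int k - 1 \<le> l\<close>; in the
      second, \<open>4 * k - 4\<close> is at least \<open>3 * k - 2\<close> because
      \<open>2 \<le> k\<close>.\<close>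
    have lower: "3 * int k - 2 \<le> int (card S2)" using T le k assms(2) by linarith
    have inj: "inj (\<lambda>i. u + i * d)" by (rule inj_affine[OF d])
    have card: "card (ba_pow ` (\<lambda>i. u + i * d) ` {0..n}) = nat (n + 1)" for n
      using card_image[OF inj_on_subset[OF inj_ba_pow]] card_image[OF inj_on_subset[OF inj]] by simp
    have cover: "S \<subseteq> ba_pow ` (\<lambda>i. u + i * d) ` {0..n}" if "l \<le> n" for n
    proof -
      have "(\<lambda>i. u + i * d) ` {0..l} \<subseteq> (\<lambda>i. u + i * d) ` {0..n}" using that by (intro image_mono) simp
      then have "A \<subseteq> (\<lambda>i. u + i * d) ` {0..n}" using A by (rule order.trans[rotated])
      then show ?thesis unfolding assms(4) ba_set_def by (rule image_mono)
    qed
    have "S = ba_pow ` (\<lambda>i. u + i * d) ` {0..int k - 1}"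
      if "k \<le> 2 \<or> 3 \<le> k \<and> int (card S2) = 3 * int k - 2"
    proof (rule card_subset_eq)
      \<comment> \<open>For \<open>3 \<le> k\<close> the value \<open>3 * k - 2\<close> lies below
        \<open>4 * k - 4\<close>, which leaves the first alternative. For \<open>k = 2\<close> the
        two numbers agree, and \<open>two\<close> decides.\<close>
      have "l \<le> int k - 1" if "3 \<le> k" "int (card S2) = 3 * int k - 2" using T that by linarith
      then have "l \<le> int k - 1" using that two k assms(2) by fastforce
      then show "S \<subseteq> ba_pow ` (\<lambda>i. u + i * d) ` {0..int k - 1}"
        by (rule cover)
    qed (simp_all add: card S)
    \<comment> \<open>Below \<open>4 * k - 4\<close> only the first alternative remains; it is
      solved for \<open>l\<close>.\<close>
    moreover have "l \<le> int k + h - 1"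
      if "int (card S2) = (3 * int k - 2) + h" "int (card S2) < 4 * int k - 4" for h
      using T that by linarith
    ultimately show ?thesis
      unfolding progression_eq_image S(1) card using lower cover k assms(2) by (intro conjI allI impI) simp_all
  qed
qed

end
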